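(* Let $G=(V,E,\mu,\omega)$ be a locally finite connected weighted graph with $\mu_0:=\inf_{x\in V}\mu(x)>0$, $M_d:=\sup_{x\in V}\deg(x)<\infty$ and $D_\mu:=\sup_{x\in V}\frac{1}{\mu(x)}\sum_{y\sim x}\omega_{xy}<\infty$. Let $\Omega$ be an unbounded subset of $V$ with $\Omega^\circ\neq\emptyset$. Let $f:\Omega^\circ\times[0,\infty)\to\mathbb{R}$ and $g:\Omega^\circ\to\mathbb{R}$ be given. Suppose that there is a constant $c=c(\Omega^\circ)>0$ such that $$\|f(\cdot,t)-f(\cdot,s)\|_{L^2(\Omega^\circ)}\le c|t-s|\qquad\text{for all }t,s\in[0,\infty),$$ and that $g\in L^2(\Omega^\circ)$. Then there exists a solution $u:V\times[0,\infty)\to\mathbb{R}$ of the parabolic variational inequality $$\int_{\Omega^\circ}\partial_t u\cdot(v-u)\,d\mu\ \ge\ \int_{\Omega^\circ}(\Delta u+f)\cdot(v-u)\,d\mu\qquad\text{for } t\in[0,\infty)\text{ and any }v\in\mathcal{H},$$ with the initial and boundary conditions $$u(x,0)=g(x)\ \text{ for }x\in\Omega^\circ,\qquad u(x,t)=0\ \text{ for }(x,t)\in(V\setminus\Omega^\circ)\times[0,\infty).$$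
   Context: A locally finite connected weighted graph $G=(V,E,\mu,\omega)$ (without isolated points) consists of a connected graph $(V,E)$ in which every vertex $x$ has at least one and only finitely many neighbours ($x\sim y$ means $xy\in E$; $\deg(x)=\#\{y\in V:y\sim x\}$), a vertex measure $\mu:V\to(0,\infty)$ and an edge weight $\omega:E\to(0,\infty)$ with $\omega_{xy}=\omega_{yx}>0$. Boundedness of subsets of $V$ refers to the graph distance. For nonempty $\Omega\subseteq V$, $\partial\Omega:=\{x\in\Omega:\text{ there is } y\in V\setminus\Omega \text{ with } y\sim x\}$ and $\Omega^\circ:=\Omega\setminus\partial\Omega$. $\int_U v\,d\mu=\sum_{x\in U}\mu(x)v(x)$ and $\|v\|_{L^2(U)}=(\int_U|v|^2\,d\mu)^{1/2}$. The $\mu$-Laplacian is $\Delta v(x)=\frac{1}{\mu(x)}\sum_{y\sim x}\omega_{xy}(v(y)-v(x))$, acting on $u(x,t)$ in $x$, and $|\nabla v|^2(x)=\frac{1}{2\mu(x)}\sum_{y\sim x}\omega_{xy}(v(y)-v(x))^2$. $W^{1,2}(V)$ is the space of $v:V\to\mathbb{R}$ with $\int_V(|\nabla v|^2+|v|^2)\,d\mu<\infty$, and $\mathcal{H}=\{v\in W^{1,2}(V): v=0\text{ on }V\setminus\Omega^\circ\}$. A solution is a function $u:V\times[0,\infty)\to\mathbb{R}$ that is continuously differentiable with respect to $t$ and satisfies the variational inequality together with the initial and boundary conditions.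
   Formalization: The integrals are required to converge only at times t with f(·,t) in L²(Ω°); if f(·,t) is not in L²(Ω°), divergent integrals are read as 0, since at t=0 the right-hand integral is then undefined for some v in H. *)

theory Defs
  imports "HOL-Analysis.Analysis"
begin

text \<open>A graph is given by a vertex set and a symmetric, irreflexive adjacency relation on it.
  The weight functions are total in HOL; only \<^term>\<open>vmeas G x\<close> for vertices \<^term>\<open>x\<close> and
  \<^term>\<open>eweight G x y\<close> for adjacent \<^term>\<open>x\<close>, \<^term>\<open>y\<close> are meaningful.\<close>

record 'a weighted_graph =
  verts :: "'a set"
  adj :: "('a \<times> 'a) set"
  vmeas :: "'a \<Rightarrow> real"
  eweight :: "'a \<Rightarrow> 'a \<Rightarrow> real"

definition nbrs :: "'a weighted_graph \<Rightarrow> 'a \<Rightarrow> 'a set" where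
  "nbrs G x = {y \<in> verts G. (x, y) \<in> adj G}"

definition locally_finite_connected_weighted_graph :: "'a weighted_graph \<Rightarrow> bool" where
  "locally_finite_connected_weighted_graph G \<longleftrightarrow>
     adj G \<subseteq> verts G \<times> verts G \<and> sym (adj G) \<and> irrefl (adj G) \<and>
     (\<forall>x\<in>verts G. \<forall>y\<in>verts G. (x, y) \<in> (adj G)\<^sup>*) \<and>
     (\<forall>x\<in>verts G. nbrs G x \<noteq> {} \<and> finite (nbrs G x)) \<and>
     (\<forall>x\<in>verts G. vmeas G x > 0) \<and>
     (\<forall>(x, y)\<in>adj G. eweight G x y > 0 \<and> eweight G x y = eweight G y x)"

definition deg :: "'a weighted_graph \<Rightarrow> 'a \<Rightarrow> nat" where
  "deg G x = card (nbrs G x)"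

definition graph_dist :: "'a weighted_graph \<Rightarrow> 'a \<Rightarrow> 'a \<Rightarrow> nat" where
  "graph_dist G x y = (LEAST n. (x, y) \<in> adj G ^^ n)"

definition graph_bounded :: "'a weighted_graph \<Rightarrow> 'a set \<Rightarrow> bool" where
  "graph_bounded G U \<longleftrightarrow> (\<exists>r. \<forall>x\<in>U. \<forall>y\<in>U. graph_dist G x y \<le> r)"

text \<open>The boundary consists of points of \<^term>\<open>\<Omega>\<close> itself, so the interior is not \<^term>\<open>\<Omega>\<close>
  unless \<^term>\<open>\<Omega>\<close> has no neighbours outside.\<close>

definition vboundary :: "'a weighted_graph \<Rightarrow> 'a set \<Rightarrow> 'a set" where
  "vboundary G \<Omega> = {x \<in> \<Omega>. \<exists>y \<in> verts G - \<Omega>. y \<in> nbrs G x}"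

definition vinterior :: "'a weighted_graph \<Rightarrow> 'a set \<Rightarrow> 'a set" where
  "vinterior G \<Omega> = \<Omega> - vboundary G \<Omega>"

text \<open>Integrals are unconditional sums. As usual \<^term>\<open>infsum\<close> is 0 on families that are not
  summable, so convergence is recorded separately by \<open>integrable_over\<close> where it matters.\<close>

definition integrable_over :: "'a weighted_graph \<Rightarrow> 'a set \<Rightarrow> ('a \<Rightarrow> real) \<Rightarrow> bool" where
  "integrable_over G U v \<longleftrightarrow> (\<lambda>x. vmeas G x * v x) summable_on U"

definition integral_over :: "'a weighted_graph \<Rightarrow> 'a set \<Rightarrow> ('a \<Rightarrow> real) \<Rightarrow> real" where
  "integral_over G U v = (\<Sum>\<^sub>\<infinity>x\<in>U. vmeas G x * v x)"

definition L2_on :: "'a weighted_graph \<Rightarrow> 'a set \<Rightarrow> ('a \<Rightarrow> real) set" where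
  "L2_on G U = {v. integrable_over G U (\<lambda>x. \<bar>v x\<bar>\<^sup>2)}"

definition L2_norm_on :: "'a weighted_graph \<Rightarrow> 'a set \<Rightarrow> ('a \<Rightarrow> real) \<Rightarrow> real" where
  "L2_norm_on G U v = sqrt (integral_over G U (\<lambda>x. \<bar>v x\<bar>\<^sup>2))"

definition laplacian :: "'a weighted_graph \<Rightarrow> ('a \<Rightarrow> real) \<Rightarrow> 'a \<Rightarrow> real" where
  "laplacian G v x = 1 / vmeas G x * (\<Sum>y\<in>nbrs G x. eweight G x y * (v y - v x))"

definition grad_sq :: "'a weighted_graph \<Rightarrow> ('a \<Rightarrow> real) \<Rightarrow> 'a \<Rightarrow> real" where
  "grad_sq G v x = 1 / (2 * vmeas G x) * (\<Sum>y\<in>nbrs G x. eweight G x y * (v y - v x)\<^sup>2)"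

definition W12 :: "'a weighted_graph \<Rightarrow> ('a \<Rightarrow> real) set" where
  "W12 G = {v. integrable_over G (verts G) (\<lambda>x. grad_sq G v x + \<bar>v x\<bar>\<^sup>2)}"

definition test_space :: "'a weighted_graph \<Rightarrow> 'a set \<Rightarrow> ('a \<Rightarrow> real) set" where
  "test_space G \<Omega> = {v \<in> W12 G. \<forall>x \<in> verts G - vinterior G \<Omega>. v x = 0}"

text \<open>The time derivative \<open>u'\<close> is one-sided at \<open>t = 0\<close>; it is uniquely determined by \<open>u\<close>.
  Both integrals in the inequality are required to converge whenever \<open>f(\<cdot>, t)\<close> is
  square-summable. This cannot be demanded for other \<open>f\<close>: convergence for all test functions
  at \<open>t = 0\<close>, with \<open>u(\<cdot>, 0) = g\<close> square-summable and a bounded Laplacian, would force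
  \<open>f(\<cdot>, 0)\<close> to be square-summable.\<close>

definition parabolic_VI_solution ::
  "'a weighted_graph \<Rightarrow> 'a set \<Rightarrow> ('a \<Rightarrow> real \<Rightarrow> real) \<Rightarrow> ('a \<Rightarrow> real) \<Rightarrow> ('a \<Rightarrow> real \<Rightarrow> real) \<Rightarrow> bool"
where
  "parabolic_VI_solution G \<Omega> f g u \<longleftrightarrow>
     (\<exists>u' :: 'a \<Rightarrow> real \<Rightarrow> real.
        (\<forall>x\<in>verts G.
           (\<forall>t\<ge>0. (u x has_real_derivative u' x t) (at t within {0..})) \<and>
           continuous_on {0..} (u' x)) \<and>
        (\<forall>t\<ge>0. \<forall>v\<in>test_space G \<Omega>.
           let lhs = (\<lambda>x. u' x t * (v x - u x t));
               rhs = (\<lambda>x. (laplacian G (\<lambda>y. u y t) x + f x t) * (v x - u x t))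
           in ((\<lambda>x. f x t) \<in> L2_on G (vinterior G \<Omega>) \<longrightarrow>
                 integrable_over G (vinterior G \<Omega>) lhs \<and>
                 integrable_over G (vinterior G \<Omega>) rhs) \<and>
              integral_over G (vinterior G \<Omega>) lhs \<ge> integral_over G (vinterior G \<Omega>) rhs)) \<and>
     (\<forall>x\<in>vinterior G \<Omega>. u x 0 = g x) \<and>
     (\<forall>x\<in>verts G - vinterior G \<Omega>. \<forall>t\<ge>0. u x t = 0)"

end

theory Submission
  imports Defs
begin

text \<open>The test space is a vector space, so the variational inequality holds as soon as
  \<open>\<partial>\<^sub>t u = \<Delta> u + f\<close> pointwise on the interior. Since the weighted degree is bounded, the Dirichlet
  Laplacian is a bounded operator on \<open>\<ell>\<^sup>2\<close>, and if \<open>f(\<cdot>, 0)\<close> is square-summable, the equation is a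
  linear ODE in \<open>\<ell>\<^sup>2\<close> with Lipschitz source, solved by Picard iteration.

  If \<open>f(\<cdot>, 0)\<close> is not square-summable, the formal definition of a solution reads a divergent
  integral as 0, and the proof relies on this convention: \<open>u\<close> satisfies the equation at \<open>t = 0\<close>, and
  a term \<open>t\<^sup>2 \<kappa>(x)\<close>, with \<open>\<kappa>\<close> growing fast along an infinite set of pairwise non-adjacent vertices,
  makes both integrals diverge at every \<open>t > 0\<close>, whatever the test function. No claim is made that
  this \<open>u\<close> solves the heat equation.\<close>

section \<open>Square-summable families\<close>

text \<open>Square summability is taken with respect to counting measure on the whole type. The
  vertex measure and the set of vertices enter later through the embedding \<open>to_ell2\<close>,
  so the type depends on no graph.\<close>

typedef 'a ell2 = "{f :: 'a \<Rightarrow> real. (\<lambda>x. (f x)\<^sup>2) summable_on UNIV}"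
  morphisms ell2_apply Ell2
  by (rule exI[of _ "\<lambda>_. 0"]) simp

setup_lifting type_definition_ell2

text \<open>The product is dominated by the sum of the squares, by expanding the square of
  \<open>\<bar>f x\<bar> - \<bar>g x\<bar>\<close>.\<close>

lemma summable_on_mult_of_squares:
  fixes f g :: "'a \<Rightarrow> real"
  assumes "(\<lambda>x. (f x)\<^sup>2) summable_on A" "(\<lambda>x. (g x)\<^sup>2) summable_on A"
  shows "(\<lambda>x. f x * g x) summable_on A"
proof -
  have "norm (f x * g x) \<le> (f x)\<^sup>2 + (g x)\<^sup>2" for x
  proof -
    have "0 \<le> (\<bar>f x\<bar> - \<bar>g x\<bar>)\<^sup>2" by simp
    then have "2 * (\<bar>f x\<bar> * \<bar>g x\<bar>) \<le> (f x)\<^sup>2 + (g x)\<^sup>2"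
      by (simp add: power2_diff algebra_simps)
    moreover have "0 \<le> \<bar>f x\<bar> * \<bar>g x\<bar>" by simp
    ultimately have "\<bar>f x\<bar> * \<bar>g x\<bar> \<le> (f x)\<^sup>2 + (g x)\<^sup>2" by linarith
    then show ?thesis by (simp add: abs_mult)
  qed
  then have "(\<lambda>x. norm (f x * g x)) summable_on A"
    by (intro summable_on_comparison_test[OF summable_on_add[OF assms]]) auto
  then show ?thesis by (rule abs_summable_summable)
qed

lemma summable_on_power2_add:
  fixes f g :: "'a \<Rightarrow> real"
  assumes "(\<lambda>x. (f x)\<^sup>2) summable_on A" "(\<lambda>x. (g x)\<^sup>2) summable_on A"
  shows "(\<lambda>x. (f x + g x)\<^sup>2) summable_on A"
proof -
  have "(\<lambda>x. 2 * (f x * g x)) summable_on A"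
    by (rule summable_on_cmult_right[OF summable_on_mult_of_squares[OF assms]])
  from summable_on_add[OF summable_on_add[OF assms] this] show ?thesis
    by (simp add: power2_sum mult.assoc)
qed

lemma ell2_eq_iff: "f = g \<longleftrightarrow> (\<forall>x. ell2_apply f x = ell2_apply g x)"
  by (auto simp: ell2_apply_inject[symmetric])

lemma summable_on_ell2_apply: "(\<lambda>x. (ell2_apply f x)\<^sup>2) summable_on A"
  using ell2_apply[of f] summable_on_subset_banach by blast

instantiation ell2 :: (type) real_vector
begin

lift_definition zero_ell2 :: "'a ell2" is "\<lambda>_. 0" by simp
lift_definition plus_ell2 :: "'a ell2 \<Rightarrow> 'a ell2 \<Rightarrow> 'a ell2" is "\<lambda>f g x. f x + g x"
  by (rule summable_on_power2_add)
lift_definition uminus_ell2 :: "'a ell2 \<Rightarrow> 'a ell2" is "\<lambda>f x. - f x" by simp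
lift_definition minus_ell2 :: "'a ell2 \<Rightarrow> 'a ell2 \<Rightarrow> 'a ell2" is "\<lambda>f g x. f x - g x"
  using summable_on_power2_add[of _ UNIV "\<lambda>x. - _ x"] by simp
lift_definition scaleR_ell2 :: "real \<Rightarrow> 'a ell2 \<Rightarrow> 'a ell2" is "\<lambda>r f x. r * f x"
  by (simp add: power_mult_distrib summable_on_cmult_right)

lemmas ell2_apply_simps [simp] =
  zero_ell2.rep_eq plus_ell2.rep_eq uminus_ell2.rep_eq minus_ell2.rep_eq scaleR_ell2.rep_eq

instance
proof
  fix f g h :: "'a ell2" and r s :: real
  show "(f + g) + h = f + (g + h)" by (simp add: ell2_eq_iff algebra_simps)
  show "f + g = g + f" by (simp add: ell2_eq_iff algebra_simps)
  show "0 + f = f" by (simp add: ell2_eq_iff)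
  show "- f + f = 0" by (simp add: ell2_eq_iff)
  show "f - g = f + - g" by (simp add: ell2_eq_iff)
  show "r *\<^sub>R (f + g) = r *\<^sub>R f + r *\<^sub>R g" by (simp add: ell2_eq_iff algebra_simps)
  show "(r + s) *\<^sub>R f = r *\<^sub>R f + s *\<^sub>R f" by (simp add: ell2_eq_iff algebra_simps)
  show "r *\<^sub>R s *\<^sub>R f = (r * s) *\<^sub>R f" by (simp add: ell2_eq_iff algebra_simps)
  show "1 *\<^sub>R f = f" by (simp add: ell2_eq_iff)
qed

end

instantiation ell2 :: (type) real_inner
begin

lift_definition inner_ell2 :: "'a ell2 \<Rightarrow> 'a ell2 \<Rightarrow> real" is "\<lambda>f g. \<Sum>\<^sub>\<infinity>x. f x * g x" .
definition norm_ell2 :: "'a ell2 \<Rightarrow> real" where "norm_ell2 f = sqrt (f \<bullet> f)"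
definition dist_ell2 :: "'a ell2 \<Rightarrow> 'a ell2 \<Rightarrow> real" where "dist_ell2 f g = norm (f - g)"
definition sgn_ell2 :: "'a ell2 \<Rightarrow> 'a ell2" where "sgn_ell2 f = f /\<^sub>R norm f"
definition uniformity_ell2 :: "('a ell2 \<times> 'a ell2) filter" where
  "uniformity_ell2 = (INF e\<in>{0<..}. principal {(f, g). dist f g < e})"
definition open_ell2 :: "'a ell2 set \<Rightarrow> bool" where
  "open_ell2 S \<longleftrightarrow> (\<forall>f\<in>S. \<forall>\<^sub>F (f', g) in uniformity. f' = f \<longrightarrow> g \<in> S)"

instance
proof
  fix f g h :: "'a ell2" and r :: real
  show "dist f g = norm (f - g)" by (rule dist_ell2_def)
  show "sgn f = f /\<^sub>R norm f" by (rule sgn_ell2_def)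
  show "uniformity = (INF e\<in>{0<..}. principal {(f :: 'a ell2, g). dist f g < e})"
    by (rule uniformity_ell2_def)
  show "open S \<longleftrightarrow> (\<forall>f\<in>S. \<forall>\<^sub>F (f', g) in uniformity. f' = f \<longrightarrow> g \<in> S)" for S :: "'a ell2 set"
    by (rule open_ell2_def)
  show "f \<bullet> g = g \<bullet> f"
    by (simp add: inner_ell2.rep_eq mult.commute)
  show "(f + g) \<bullet> h = f \<bullet> h + g \<bullet> h"
    by (simp add: inner_ell2.rep_eq distrib_right infsum_add summable_on_mult_of_squares
        summable_on_ell2_apply)
  show "(r *\<^sub>R f) \<bullet> g = r * (f \<bullet> g)"
    by (simp add: inner_ell2.rep_eq mult.assoc infsum_cmult_right')
  show "0 \<le> f \<bullet> f" by (simp add: inner_ell2.rep_eq infsum_nonneg)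
  show "f \<bullet> f = 0 \<longleftrightarrow> f = 0"
  proof
    assume "f \<bullet> f = 0"
    then have "(\<Sum>\<^sub>\<infinity>x. (ell2_apply f x)\<^sup>2) \<le> 0"
      by (simp add: inner_ell2.rep_eq power2_eq_square)
    then have "(ell2_apply f x)\<^sup>2 = 0" for x
      by (rule nonneg_infsum_le_0D) (auto simp: summable_on_ell2_apply)
    then show "f = 0" by (simp add: ell2_eq_iff)
  qed (simp add: inner_ell2.rep_eq)
  show "norm f = sqrt (f \<bullet> f)" by (rule norm_ell2_def)
qed

end

lemma norm_ell2_power2: "(norm f)\<^sup>2 = (\<Sum>\<^sub>\<infinity>x. (ell2_apply f x)\<^sup>2)"
  unfolding power2_norm_eq_inner inner_ell2.rep_eq by (simp add: power2_eq_square)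

lemma sum_ell2_apply_le: "finite F \<Longrightarrow> (\<Sum>x\<in>F. (ell2_apply f x)\<^sup>2) \<le> (norm f)\<^sup>2"
  unfolding norm_ell2_power2
  by (rule finite_sum_le_infsum) (auto simp: summable_on_ell2_apply)

lemma abs_ell2_apply_le: "\<bar>ell2_apply f x\<bar> \<le> norm f"
  using sum_ell2_apply_le[of "{x}" f] by (simp add: power2_le_iff_abs_le)

lemma bounded_linear_ell2_apply: "bounded_linear (\<lambda>f. ell2_apply f x)"
  by (rule bounded_linear_intro[where K = 1])
    (auto simp: abs_ell2_apply_le)

text \<open>Uniform bounds on finite partial sums are what survives pointwise limits and the
  exchange of finite sums. This turns such bounds into an element of \<open>ell2\<close> with a norm
  estimate, for completeness and for the Laplacian.\<close>

lemma ell2I: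
  fixes h :: "'a \<Rightarrow> real"
  assumes "\<And>F. finite F \<Longrightarrow> (\<Sum>x\<in>F. (h x)\<^sup>2) \<le> C\<^sup>2" "0 \<le> C"
  obtains f where "ell2_apply f = h" "norm f \<le> C"
proof -
  have sm: "(\<lambda>x. (h x)\<^sup>2) summable_on UNIV"
    by (rule nonneg_bdd_above_summable_on) (auto intro!: bdd_aboveI[of _ "C\<^sup>2"] assms)
  then have eq: "ell2_apply (Ell2 h) = h" by (simp add: Ell2_inverse)
  have "(norm (Ell2 h))\<^sup>2 \<le> C\<^sup>2"
    unfolding norm_ell2_power2 eq
    by (rule infsum_le_finite_sums) (use sm assms in auto)
  then show thesis using that[OF eq] assms(2) by (simp add: power2_le_iff_abs_le)
qed

text \<open>A Cauchy sequence converges coordinatewise to some \<open>h\<close>. In the Cauchy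
  estimate on a finite set of coordinates one index is sent to infinity, which bounds
  \<open>h - X n\<close> in norm.\<close>

instance ell2 :: (type) banach
proof
  fix X :: "nat \<Rightarrow> 'a ell2"
  assume X: "Cauchy X"
  define h where "h x = lim (\<lambda>n. ell2_apply (X n) x)" for x
  have lim: "(\<lambda>n. ell2_apply (X n) x) \<longlonglongrightarrow> h x" for x
    using bounded_linear.Cauchy[OF bounded_linear_ell2_apply X]
    unfolding h_def by (simp add: Cauchy_convergent_iff convergent_LIMSEQ_iff)
  have tail: "\<exists>N. \<forall>n\<ge>N. \<exists>d. ell2_apply d = (\<lambda>x. h x - ell2_apply (X n) x) \<and> norm d \<le> e"
    if "e > 0" for e
  proof -
    obtain N where N: "\<And>m n. m \<ge> N \<Longrightarrow> n \<ge> N \<Longrightarrow> norm (X m - X n) < e"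
      using X \<open>e > 0\<close> unfolding Cauchy_iff by blast
    have "\<exists>d. ell2_apply d = (\<lambda>x. h x - ell2_apply (X n) x) \<and> norm d \<le> e" if "n \<ge> N" for n
    proof -
      have "(\<Sum>x\<in>F. (h x - ell2_apply (X n) x)\<^sup>2) \<le> e\<^sup>2" if "finite F" for F
      proof (rule LIMSEQ_le_const2)
        show "(\<lambda>m. \<Sum>x\<in>F. (ell2_apply (X m) x - ell2_apply (X n) x)\<^sup>2)
            \<longlonglongrightarrow> (\<Sum>x\<in>F. (h x - ell2_apply (X n) x)\<^sup>2)"
          by (intro tendsto_intros lim)
        have "(\<Sum>x\<in>F. (ell2_apply (X m) x - ell2_apply (X n) x)\<^sup>2) \<le> e\<^sup>2" if "m \<ge> N" for m
        proof -
          have "(\<Sum>x\<in>F. (ell2_apply (X m) x - ell2_apply (X n) x)\<^sup>2) \<le> (norm (X m - X n))\<^sup>2"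
            using sum_ell2_apply_le[OF \<open>finite F\<close>, of "X m - X n"] by simp
          also have "\<dots> \<le> e\<^sup>2"
            using N[OF that \<open>n \<ge> N\<close>] by (intro power_mono) auto
          finally show ?thesis .
        qed
        then show "\<exists>N. \<forall>m\<ge>N. (\<Sum>x\<in>F. (ell2_apply (X m) x - ell2_apply (X n) x)\<^sup>2) \<le> e\<^sup>2"
          by blast
      qed
      then show ?thesis
        using \<open>e > 0\<close> by (blast intro: ell2I[of "\<lambda>x. h x - ell2_apply (X n) x" e] less_imp_le)
    qed
    then show ?thesis by blast
  qed
  \<comment> \<open>One such difference already shows that \<open>h\<close> itself is
    square-summable, since \<open>h\<close> is \<open>d\<close> plus a member of the
    sequence.\<close>
  obtain N d where d: "ell2_apply d = (\<lambda>x. h x - ell2_apply (X N) x)"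
    using tail[of 1] by auto
  define L where "L = d + X N"
  have L: "ell2_apply L = h" by (simp add: L_def fun_eq_iff d)
  have "X \<longlonglongrightarrow> L"
  proof (rule LIMSEQ_I)
    fix e :: real assume "e > 0"
    then obtain N where N: "\<forall>n\<ge>N. \<exists>d. ell2_apply d = (\<lambda>x. h x - ell2_apply (X n) x) \<and> norm d \<le> e / 2"
      using tail[of "e / 2"] by auto
    have "norm (X n - L) < e" if n: "n \<ge> N" for n
    proof -
      obtain d where "ell2_apply d = (\<lambda>x. h x - ell2_apply (X n) x)" "norm d \<le> e / 2"
        using N n by blast
      then have "d = L - X n" by (simp add: ell2_eq_iff L)
      with \<open>norm d \<le> e / 2\<close> \<open>e > 0\<close> show ?thesis
        using norm_minus_commute[of L "X n"] by simp
    qed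
    then show "\<exists>N. \<forall>n\<ge>N. norm (X n - L) < e" by blast
  qed
  then show "convergent X" by (rule convergentI)
qed

section \<open>Divergence of weighted sums and independent sets of vertices\<close>

text \<open>Unconditional convergence in the reals is absolute, and enough terms of size at least
  \<open>e\<close> would exceed the sum of absolute values.\<close>

lemma finite_ge_of_summable_on:
  fixes f :: "'a \<Rightarrow> real"
  assumes f: "f summable_on A" and "0 < e"
  shows "finite {x \<in> A. e \<le> \<bar>f x\<bar>}"
proof (rule ccontr)
  assume inf: "infinite {x \<in> A. e \<le> \<bar>f x\<bar>}"
  have abs: "(\<lambda>x. \<bar>f x\<bar>) summable_on A"
    using f summable_on_iff_abs_summable_on_real[of f A] by simp
  obtain n where n: "(\<Sum>\<^sub>\<infinity>x\<in>A. \<bar>f x\<bar>) < real n * e"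
    using reals_Archimedean3[OF \<open>0 < e\<close>] by blast
  obtain F where F: "finite F" "card F = n" "F \<subseteq> {x \<in> A. e \<le> \<bar>f x\<bar>}"
    using infinite_arbitrarily_large[OF inf] by blast
  have "real n * e = (\<Sum>x\<in>F. e)" using F by simp
  also have "\<dots> \<le> (\<Sum>x\<in>F. \<bar>f x\<bar>)" using F by (intro sum_mono) auto
  also have "\<dots> \<le> (\<Sum>\<^sub>\<infinity>x\<in>A. \<bar>f x\<bar>)" using F abs by (intro finite_sum_le_infsum) auto
  finally show False using n by simp
qed

text \<open>A square-summable \<open>w\<close> is smaller than 1/2 at all but finitely many points
  of \<open>I\<close>. There \<open>w - b\<close> still has size at least 1/2, so the product does
  not tend to 0. Hence no test function can compensate a large \<open>b\<close>.\<close>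

lemma not_summable_on_mult_diff:
  fixes a b w :: "'a \<Rightarrow> real"
  assumes w: "(\<lambda>x. (w x)\<^sup>2) summable_on A"
    and I: "infinite I" "I \<subseteq> A"
    and ab: "\<And>x. x \<in> I \<Longrightarrow> 1 \<le> \<bar>a x\<bar>" "\<And>x. x \<in> I \<Longrightarrow> 1 \<le> \<bar>b x\<bar>"
  shows "\<not> (\<lambda>x. a x * (w x - b x)) summable_on A"
proof
  assume "(\<lambda>x. a x * (w x - b x)) summable_on A"
  from finite_ge_of_summable_on[OF this, of "1/2"] finite_ge_of_summable_on[OF w, of "(1/2)\<^sup>2"]
  have "finite ({x \<in> A. 1/2 \<le> \<bar>a x * (w x - b x)\<bar>} \<union> {x \<in> A. (1/2)\<^sup>2 \<le> \<bar>(w x)\<^sup>2\<bar>})"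
    by simp
  moreover have "I \<subseteq> {x \<in> A. 1/2 \<le> \<bar>a x * (w x - b x)\<bar>} \<union> {x \<in> A. (1/2)\<^sup>2 \<le> \<bar>(w x)\<^sup>2\<bar>}"
  proof
    fix x assume x: "x \<in> I"
    show "x \<in> {x \<in> A. 1/2 \<le> \<bar>a x * (w x - b x)\<bar>} \<union> {x \<in> A. (1/2)\<^sup>2 \<le> \<bar>(w x)\<^sup>2\<bar>}"
    proof (cases "1/2 \<le> \<bar>w x\<bar>")
      case True
      then have "(1/2)\<^sup>2 \<le> \<bar>w x\<bar>\<^sup>2" by (intro power_mono) auto
      then show ?thesis using x I by auto
    next
      case False
      then have "1/2 \<le> \<bar>w x - b x\<bar>" using ab(2)[OF x] by linarith
      then have "1 * (1/2) \<le> \<bar>a x\<bar> * \<bar>w x - b x\<bar>"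
        using ab(1)[OF x] by (intro mult_mono) auto
      then show ?thesis using x I by (auto simp: abs_mult)
    qed
  qed
  ultimately show False using I(1) finite_subset by blast
qed

text \<open>Greedy choice: the finitely many earlier points and their finite sets \<open>N\<close>
  exclude only finitely many candidates. Only the later point is controlled; for neighbourhoods,
  symmetry of adjacency gives the other order.\<close>

lemma infinite_independent_sequence:
  assumes "infinite A" and "\<And>x. x \<in> A \<Longrightarrow> finite (N x)"
  obtains s :: "nat \<Rightarrow> 'a" where "inj s" "range s \<subseteq> A" "\<And>i j. i < j \<Longrightarrow> s j \<notin> N (s i)"
proof -
  have "\<exists>s :: nat \<Rightarrow> 'a. \<forall>n. s n \<in> A \<and> (\<forall>i<n. s n \<noteq> s i \<and> s n \<notin> N (s i))"
  proof (rule dependent_wellorder_choice)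
    fix n and s :: "nat \<Rightarrow> 'a"
    assume s: "\<And>m. m < n \<Longrightarrow> s m \<in> A \<and> (\<forall>i<m. s m \<noteq> s i \<and> s m \<notin> N (s i))"
    have "finite (\<Union>i<n. insert (s i) (N (s i)))" using s assms(2) by auto
    then obtain r where "r \<in> A" "r \<notin> (\<Union>i<n. insert (s i) (N (s i)))"
      using assms(1) by (meson finite_subset subsetI)
    then show "\<exists>r. r \<in> A \<and> (\<forall>i<n. r \<noteq> s i \<and> r \<notin> N (s i))" by auto
  qed auto
  then obtain s :: "nat \<Rightarrow> 'a"
    where s: "\<And>n. s n \<in> A" "\<And>i n. i < n \<Longrightarrow> s n \<noteq> s i" "\<And>i n. i < n \<Longrightarrow> s n \<notin> N (s i)"
    by blast
  have "inj s" by (rule linorder_injI) (metis s(2))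
  then show thesis using s that by blast
qed

section \<open>Linear differential equations in Banach spaces\<close>

text \<open>The Picard iterates are written as a series of increments \<open>w n\<close>, whose
  factorial decay gives locally uniform convergence. Differentiating term by term shifts the index
  and reproduces \<open>A U + F\<close>.\<close>

lemma inhomogeneous_linear_ode_solution:
  fixes A :: "'a::banach \<Rightarrow> 'a"
  assumes A: "bounded_linear A" and F: "continuous_on {0..} F"
  obtains U where "U 0 = a"
    "\<And>t. t \<ge> 0 \<Longrightarrow> (U has_vector_derivative A (U t) + F t) (at t within {0..})"
proof -
  interpret A: bounded_linear A by (rule A)
  obtain K where K: "K > 0" "\<And>x. norm (A x) \<le> K * norm x"
    using A.pos_bounded by (auto simp: mult.commute)
  define w where "w = rec_nat (\<lambda>t. a + integral {0..t} F) (\<lambda>_ v t. integral {0..t} (\<lambda>s. A (v s)))"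
  define w' where "w' n t = (case n of 0 \<Rightarrow> F t | Suc m \<Rightarrow> A (w m t))" for n t
  define U where "U t = (\<Sum>n. w n t)" for t
  have w_0: "w n 0 = (if n = 0 then a else 0)" for n
    by (cases n) (auto simp: w_def)
  have w_deriv: "(w n has_vector_derivative w' n t) (at t within {0..T})" if "t \<in> {0..T}" for n t T
    using that
  proof (induction n arbitrary: t)
    case 0
    have "((\<lambda>t. a + integral {0..t} F) has_vector_derivative 0 + F t) (at t within {0..T})"
      using 0 by (intro has_vector_derivative_add has_vector_derivative_const
        integral_has_vector_derivative continuous_on_subset[OF F]) auto
    then show ?case by (simp add: w_def w'_def)
  next
    case (Suc n)
    have "continuous_on {0..T} (w n)"
      by (rule continuous_on_vector_derivative[where f' = "w' n"]) (rule Suc.IH)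
    then have "continuous_on {0..T} (\<lambda>s. A (w n s))"
      by (rule A.continuous_on)
    then have "((\<lambda>t. integral {0..t} (\<lambda>s. A (w n s))) has_vector_derivative A (w n t)) (at t within {0..T})"
      using Suc.prems by (rule integral_has_vector_derivative)
    then show ?case by (simp add: w_def w'_def)
  qed
  \<comment> \<open>\<open>C\<close> bounds \<open>w 0\<close> on the compact interval. Each further
    integration contributes a factor \<open>K\<close> and one power of \<open>t\<close> divided by
    the next integer.\<close>
  have bound: "\<exists>C. \<forall>n. \<forall>t\<in>{0..T}. norm (w n t) \<le> C * (K * t) ^ n / fact n" for T
  proof -
    have cont: "continuous_on {0..T} (w n)" for n
      by (rule continuous_on_vector_derivative[where f' = "w' n"]) (rule w_deriv)
    then have "bounded (w 0 ` {0..T})"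
      by (intro compact_imp_bounded compact_continuous_image) auto
    then obtain C where C: "\<And>t. t \<in> {0..T} \<Longrightarrow> norm (w 0 t) \<le> C"
      unfolding bounded_iff by blast
    have "norm (w n t) \<le> C * (K * t) ^ n / fact n" if "t \<in> {0..T}" for n t
      using that
    proof (induction n arbitrary: t)
      case 0
      then show ?case using C by simp
    next
      case (Suc n)
      show ?case
      \<comment> \<open>The mean value inequality below is applied on \<open>{0..t}\<close> and
        needs \<open>0 < t\<close>.\<close>
      proof (cases "t = 0")
        case True
        then show ?thesis by (simp add: w_0)
      next
        case False
        then have t: "0 < t" "t \<le> T" using Suc.prems by auto
        let ?\<phi> = "\<lambda>s. C * (K * s) ^ Suc n / fact (Suc n)"
        have "norm (w (Suc n) t - w (Suc n) 0) \<le> ?\<phi> t - ?\<phi> 0"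
        proof (rule differentiable_bound_general[where f' = "w' (Suc n)" and \<phi>' = "\<lambda>s. K * (C * (K * s) ^ n / fact n)"])
          show "continuous_on {0..t} (w (Suc n))"
            using t by (intro continuous_on_subset[OF cont]) auto
          show "continuous_on {0..t} ?\<phi>" by (intro continuous_intros) auto
          fix s assume s: "0 < s" "s < t"
          have "(w (Suc n) has_vector_derivative w' (Suc n) s) (at s within {0..T})"
            using s t by (intro w_deriv) auto
          then show "(w (Suc n) has_vector_derivative w' (Suc n) s) (at s)"
            using s t at_within_interior[of s "{0..T}"] by simp
          have "((\<lambda>s. K * s) has_real_derivative K) (at s)"
            using DERIV_cmult_Id by blast
          from DERIV_cdivide[OF DERIV_cmult[OF DERIV_power_Suc[OF this]]]
          have "(?\<phi> has_real_derivative C * ((1 + real n) * (K * (K * s) ^ n)) / fact (Suc n)) (at s)"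
            by blast
          moreover have "C * ((1 + real n) * (K * (K * s) ^ n)) / fact (Suc n) = K * (C * (K * s) ^ n / fact n)"
            by (simp add: divide_simps)
          ultimately have "(?\<phi> has_real_derivative K * (C * (K * s) ^ n / fact n)) (at s)"
            by (simp only:)
          then show "(?\<phi> has_vector_derivative K * (C * (K * s) ^ n / fact n)) (at s)"
            by (simp add: has_real_derivative_iff_has_vector_derivative)
          have "norm (w n s) \<le> C * (K * s) ^ n / fact n"
            using s t by (intro Suc.IH) auto
          then show "norm (w' (Suc n) s) \<le> K * (C * (K * s) ^ n / fact n)"
            using order_trans[OF K(2) mult_left_mono] K(1) by (simp add: w'_def del: times_divide_eq_right)
        qed (use t in auto)
        then show ?thesis by (simp add: w_0)
      qed
    qed
    then show ?thesis by blast
  qed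
  have unif: "uniform_limit {0..T} (\<lambda>n t. \<Sum>i<n. w i t) U sequentially" for T
  proof -
    obtain C where C: "\<And>n t. t \<in> {0..T} \<Longrightarrow> norm (w n t) \<le> C * (K * t) ^ n / fact n"
      using bound[of T] by blast
    have le: "norm (w n t) \<le> \<bar>C\<bar> * ((K * T) ^ n / fact n)" if t: "t \<in> {0..T}" for n t
    proof -
      have "C * (K * t) ^ n \<le> \<bar>C\<bar> * (K * T) ^ n"
        using t K by (intro mult_mono power_mono) auto
      then show ?thesis using C[OF t, of n] by (simp add: divide_right_mono order_trans)
    qed
    have "summable (\<lambda>n. \<bar>C\<bar> * ((K * T) ^ n / fact n))"
      using summable_exp_generic[of "K * T"] by (intro summable_mult) (simp add: field_simps)
    then show ?thesis
      unfolding U_def by (intro Weierstrass_m_test) (use le in auto)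
  qed
  have sums: "(\<lambda>n. w n t) sums U t" if "t \<ge> 0" for t
    using tendsto_uniform_limitI[OF unif[of t], of t] that by (simp add: sums_def)
  have deriv: "(U has_vector_derivative A (U t) + F t) (at t within {0..T})" if "t \<in> {0..T}" for t T
  proof -
    \<comment> \<open>Termwise differentiation yields some differentiable sum; uniqueness of sums
      identifies it with \<open>U\<close> afterwards.\<close>
    have "\<exists>g. \<forall>x\<in>{0..T}. (\<lambda>n. w n x) sums g x \<and>
        (g has_derivative (\<lambda>h. h *\<^sub>R (A (U x) + F x))) (at x within {0..T})"
    proof (rule has_derivative_series[where f' = "\<lambda>n x h. h *\<^sub>R w' n x" and x = t and l = "U t"])
      show "(w n has_derivative (\<lambda>h. h *\<^sub>R w' n x)) (at x within {0..T})" if "x \<in> {0..T}" for n x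
        using w_deriv[OF that] by (simp add: has_vector_derivative_def)
      fix e :: real assume "e > 0"
      then have "e / K > 0" using K by simp
      \<comment> \<open>The tolerance \<open>e / K\<close> becomes \<open>e\<close> after
        \<open>A\<close> is applied to the remainder of the series.\<close>
      then obtain N where N: "\<And>n x. n \<ge> N \<Longrightarrow> x \<in> {0..T} \<Longrightarrow> norm ((\<Sum>i<n. w i x) - U x) < e / K"
        using unif[of T] unfolding uniform_limit_iff dist_norm eventually_sequentially by metis
      have "norm ((\<Sum>i<n. h *\<^sub>R w' i x) - h *\<^sub>R (A (U x) + F x)) \<le> e * norm h"
        if n: "n \<ge> Suc N" and x: "x \<in> {0..T}" for n x h
      proof -
        obtain m where m: "n = Suc m" "m \<ge> N" using n by (cases n) auto
        \<comment> \<open>The term of index 0 cancels \<open>F x\<close>; the others are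
          \<open>A\<close> applied to the increments of one index lower, hence \<open>Suc m\<close>
          against \<open>m\<close>.\<close>
        have "(\<Sum>i<n. w' i x) - (A (U x) + F x) = A ((\<Sum>i<m. w i x) - U x)"
          unfolding m(1) sum.lessThan_Suc_shift by (simp add: w'_def A.diff A.sum)
        also have "norm \<dots> \<le> K * (e / K)"
          using N[OF m(2) x] K by (intro order_trans[OF K(2)] mult_left_mono) auto
        finally have "norm ((\<Sum>i<n. w' i x) - (A (U x) + F x)) \<le> e" using K by simp
        then have "\<bar>h\<bar> * norm ((\<Sum>i<n. w' i x) - (A (U x) + F x)) \<le> \<bar>h\<bar> * e"
          by (intro mult_left_mono) auto
        then show ?thesis
          by (simp add: scaleR_sum_right[symmetric] scaleR_diff_right[symmetric] mult.commute)
      qed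
      then show "\<forall>\<^sub>F n in sequentially. \<forall>x\<in>{0..T}. \<forall>h.
          norm ((\<Sum>i<n. h *\<^sub>R w' i x) - h *\<^sub>R (A (U x) + F x)) \<le> e * norm h"
        unfolding eventually_sequentially by blast
    qed (use that sums in auto)
    then obtain G where G: "\<And>x. x \<in> {0..T} \<Longrightarrow> (\<lambda>n. w n x) sums G x"
        "\<And>x. x \<in> {0..T} \<Longrightarrow> (G has_derivative (\<lambda>h. h *\<^sub>R (A (U x) + F x))) (at x within {0..T})"
      by blast
    have "G x = U x" if "x \<in> {0..T}" for x
      using G(1)[OF that] sums[of x] that sums_unique2 by auto
    then have "(U has_derivative (\<lambda>h. h *\<^sub>R (A (U t) + F t))) (at t within {0..T})"
      using has_derivative_transform[OF _ _ G(2)] that by metis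
    then show ?thesis by (simp add: has_vector_derivative_def)
  qed
  show thesis
  proof (rule that)
    show "U 0 = a" using sums[of 0] sums_unique2[OF sums_If_finite[of "\<lambda>n. n = 0" "\<lambda>_. a"]]
      by (auto simp: w_0)
    fix t :: real assume "t \<ge> 0"
    \<comment> \<open>Differentiability is local, so the half-line may be replaced by a compact
      interval reaching beyond \<open>t\<close>.\<close>
    have "at t within {0..} = at t within {0..t + 1}"
      by (rule at_within_nhd[of _ "{..<t + 1}"]) auto
    then show "(U has_vector_derivative A (U t) + F t) (at t within {0..})"
      using deriv[of t "t + 1"] \<open>t \<ge> 0\<close> by simp
  qed
qed

section \<open>The Laplacian on a graph of bounded weighted degree\<close>

locale bounded_weighted_graph =
  fixes G :: "'a weighted_graph" and D :: real
  assumes graph: "locally_finite_connected_weighted_graph G"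
    and D_nonneg: "0 \<le> D"
    and weight_sum_le: "x \<in> verts G \<Longrightarrow> (\<Sum>y\<in>nbrs G x. eweight G x y) \<le> D * vmeas G x"
begin

lemma finite_nbrs: "x \<in> verts G \<Longrightarrow> finite (nbrs G x)"
  and nbrs_nonempty: "x \<in> verts G \<Longrightarrow> nbrs G x \<noteq> {}"
  and vmeas_pos: "x \<in> verts G \<Longrightarrow> 0 < vmeas G x"
  using graph by (auto simp: locally_finite_connected_weighted_graph_def)

lemma nbrs_subset: "nbrs G x \<subseteq> verts G"
  by (auto simp: nbrs_def)

lemma nbrs_sym: "x \<in> verts G \<Longrightarrow> y \<in> nbrs G x \<Longrightarrow> x \<in> nbrs G y"
  using graph by (auto simp: locally_finite_connected_weighted_graph_def nbrs_def dest: symD)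

lemma not_in_nbrs_self: "x \<notin> nbrs G x"
  using graph by (auto simp: locally_finite_connected_weighted_graph_def nbrs_def irrefl_def)

lemma eweight_pos: "y \<in> nbrs G x \<Longrightarrow> 0 < eweight G x y"
  and eweight_sym: "y \<in> nbrs G x \<Longrightarrow> eweight G x y = eweight G y x"
  using graph by (auto simp: locally_finite_connected_weighted_graph_def nbrs_def)

text \<open>Cauchy-Schwarz with each edge weight split into two square roots: one factor is the
  weighted degree, bounded by \<open>D * vmeas G x\<close>; in the other the squared difference is
  at most twice the sum of the squares.\<close>

lemma vmeas_laplacian_power2_le:
  assumes x: "x \<in> verts G"
  shows "vmeas G x * (laplacian G v x)\<^sup>2
    \<le> 2 * D * (\<Sum>y\<in>nbrs G x. eweight G x y * (v y)\<^sup>2) + 2 * D\<^sup>2 * (vmeas G x * (v x)\<^sup>2)"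
proof -
  let ?S = "\<lambda>h. \<Sum>y\<in>nbrs G x. eweight G x y * h y"
  have w: "y \<in> nbrs G x \<Longrightarrow> 0 \<le> eweight G x y" for y
    using eweight_pos[of y x] by simp
  have m: "0 < vmeas G x" using x by (rule vmeas_pos)
  have "(?S (\<lambda>y. v y - v x))\<^sup>2
      = (\<Sum>y\<in>nbrs G x. sqrt (eweight G x y) * (sqrt (eweight G x y) * (v y - v x)))\<^sup>2"
    using w by (intro arg_cong[where f = "\<lambda>s. s\<^sup>2"] sum.cong) (auto simp flip: mult.assoc)
  also have "\<dots> \<le> (\<Sum>y\<in>nbrs G x. (sqrt (eweight G x y))\<^sup>2)
      * (\<Sum>y\<in>nbrs G x. (sqrt (eweight G x y) * (v y - v x))\<^sup>2)"
    by (rule Cauchy_Schwarz_ineq_sum)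
  also have "\<dots> = (\<Sum>y\<in>nbrs G x. eweight G x y) * ?S (\<lambda>y. (v y - v x)\<^sup>2)"
    using w by (intro arg_cong2[where f = "(*)"] sum.cong) (auto simp: power_mult_distrib)
  also have "\<dots> \<le> (D * vmeas G x) * ?S (\<lambda>y. 2 * (v y)\<^sup>2 + 2 * (v x)\<^sup>2)"
  proof (intro mult_mono sum_mono)
    show "(v y - v x)\<^sup>2 \<le> 2 * (v y)\<^sup>2 + 2 * (v x)\<^sup>2" for y
      \<comment> \<open>The gap between the two sides is exactly the square of
        \<open>v y + v x\<close>.\<close>
      using sum_squares_ge_zero[of "v y + v x" 0] by (simp add: power2_eq_square algebra_simps)
  qed (use w x m D_nonneg in \<open>auto intro!: weight_sum_le sum_nonneg\<close>)
  also have "?S (\<lambda>y. 2 * (v y)\<^sup>2 + 2 * (v x)\<^sup>2)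
      = 2 * ?S (\<lambda>y. (v y)\<^sup>2) + 2 * (v x)\<^sup>2 * (\<Sum>y\<in>nbrs G x. eweight G x y)"
    by (simp add: distrib_left sum.distrib sum_distrib_left mult_ac)
  also have "(D * vmeas G x) * \<dots>
      \<le> (D * vmeas G x) * (2 * ?S (\<lambda>y. (v y)\<^sup>2) + 2 * (v x)\<^sup>2 * (D * vmeas G x))"
    using x m D_nonneg by (intro mult_left_mono add_left_mono weight_sum_le) auto
  finally have "(?S (\<lambda>y. v y - v x))\<^sup>2 / vmeas G x
      \<le> (D * vmeas G x) * (2 * ?S (\<lambda>y. (v y)\<^sup>2) + 2 * (v x)\<^sup>2 * (D * vmeas G x)) / vmeas G x"
    using m by (intro divide_right_mono) auto
  also have "\<dots> = 2 * D * ?S (\<lambda>y. (v y)\<^sup>2) + 2 * D\<^sup>2 * (vmeas G x * (v x)\<^sup>2)"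
    using m by (simp add: field_simps power2_eq_square)
  also have "(?S (\<lambda>y. v y - v x))\<^sup>2 / vmeas G x = vmeas G x * (laplacian G v x)\<^sup>2"
    using m by (simp add: laplacian_def power2_eq_square)
  finally show ?thesis .
qed

text \<open>After the double sum is exchanged, symmetry of the weights makes the total weight
  arriving at \<open>y\<close> at most \<open>D * vmeas G y\<close>. The neighbours of
  \<open>F\<close> may lie outside \<open>F\<close>, so \<open>M\<close> has to bound all finite
  sums. The result gives operator norm at most \<open>2 * D\<close>.\<close>

lemma sum_vmeas_laplacian_le:
  assumes M: "\<And>F. finite F \<Longrightarrow> F \<subseteq> verts G \<Longrightarrow> (\<Sum>x\<in>F. vmeas G x * (v x)\<^sup>2) \<le> M"
    and F: "finite F" "F \<subseteq> verts G"
  shows "(\<Sum>x\<in>F. vmeas G x * (laplacian G v x)\<^sup>2) \<le> 4 * D\<^sup>2 * M"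
proof -
  define B where "B = (\<Union>x\<in>F. nbrs G x)"
  have B: "finite B" "B \<subseteq> verts G"
    using F finite_nbrs nbrs_subset by (auto simp: B_def)
  have "(\<Sum>x\<in>F. \<Sum>y\<in>nbrs G x. eweight G x y * (v y)\<^sup>2)
      = (\<Sum>x\<in>F. \<Sum>y | y \<in> B \<and> y \<in> nbrs G x. eweight G x y * (v y)\<^sup>2)"
    by (intro sum.cong) (auto simp: B_def)
  also have "\<dots> = (\<Sum>y\<in>B. \<Sum>x | x \<in> F \<and> y \<in> nbrs G x. eweight G x y * (v y)\<^sup>2)"
    using F(1) B(1) by (rule sum.swap_restrict)
  also have "\<dots> \<le> (\<Sum>y\<in>B. D * (vmeas G y * (v y)\<^sup>2))"
  proof (rule sum_mono)
    fix y assume "y \<in> B"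
    then have y: "y \<in> verts G" using B by auto
    have "(\<Sum>x | x \<in> F \<and> y \<in> nbrs G x. eweight G x y)
        = (\<Sum>x | x \<in> F \<and> y \<in> nbrs G x. eweight G y x)"
      by (intro sum.cong) (use eweight_sym in blast)+
    also have "\<dots> \<le> (\<Sum>x\<in>nbrs G y. eweight G y x)"
      using F nbrs_sym finite_nbrs[OF y] eweight_pos[of _ y]
      by (intro sum_mono2) (auto simp: less_imp_le)
    also have "\<dots> \<le> D * vmeas G y" using y by (rule weight_sum_le)
    finally have "(\<Sum>x | x \<in> F \<and> y \<in> nbrs G x. eweight G x y) * (v y)\<^sup>2 \<le> D * vmeas G y * (v y)\<^sup>2"
      by (intro mult_right_mono) auto
    then show "(\<Sum>x | x \<in> F \<and> y \<in> nbrs G x. eweight G x y * (v y)\<^sup>2) \<le> D * (vmeas G y * (v y)\<^sup>2)"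
      by (simp add: sum_distrib_right mult.assoc)
  qed
  also have "\<dots> = D * (\<Sum>y\<in>B. vmeas G y * (v y)\<^sup>2)" by (simp add: sum_distrib_left)
  also have "\<dots> \<le> D * M" using B D_nonneg by (intro mult_left_mono M)
  finally have nb: "(\<Sum>x\<in>F. \<Sum>y\<in>nbrs G x. eweight G x y * (v y)\<^sup>2) \<le> D * M" .
  have "(\<Sum>x\<in>F. vmeas G x * (laplacian G v x)\<^sup>2)
      \<le> (\<Sum>x\<in>F. 2 * D * (\<Sum>y\<in>nbrs G x. eweight G x y * (v y)\<^sup>2) + 2 * D\<^sup>2 * (vmeas G x * (v x)\<^sup>2))"
    using F by (intro sum_mono vmeas_laplacian_power2_le) auto
  also have "\<dots> = 2 * D * (\<Sum>x\<in>F. \<Sum>y\<in>nbrs G x. eweight G x y * (v y)\<^sup>2)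
      + 2 * D\<^sup>2 * (\<Sum>x\<in>F. vmeas G x * (v x)\<^sup>2)"
    by (simp add: sum.distrib sum_distrib_left)
  also have "\<dots> \<le> 2 * D * (D * M) + 2 * D\<^sup>2 * M"
    using D_nonneg F by (intro add_mono mult_left_mono nb M) auto
  finally show ?thesis by (simp add: power2_eq_square algebra_simps)
qed

lemma laplacian_add: "laplacian G (\<lambda>y. v y + w y) x = laplacian G v x + laplacian G w x"
  by (simp add: laplacian_def sum.distrib sum_subtractf algebra_simps add_divide_distrib diff_divide_distrib)

lemma laplacian_cmult: "laplacian G (\<lambda>y. r * v y) x = r * laplacian G v x"
  by (simp add: laplacian_def sum_distrib_left algebra_simps)

section \<open>Weighted square-summable functions as elements of \<open>ell2\<close>\<close>

text \<open>The gradient term is nonnegative, so the integrand defining \<open>W12\<close> dominates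
  the weighted square.\<close>

lemma test_space_square_summable:
  assumes "v \<in> test_space G \<Omega>"
  shows "(\<lambda>x. (sqrt (vmeas G x) * v x)\<^sup>2) summable_on verts G"
proof -
  have "(\<lambda>x. vmeas G x * (grad_sq G v x + \<bar>v x\<bar>\<^sup>2)) summable_on verts G"
    using assms by (simp add: test_space_def W12_def integrable_over_def)
  then show ?thesis
  proof (rule summable_on_comparison_test)
    fix x assume x: "x \<in> verts G"
    have "0 \<le> grad_sq G v x"
      using x vmeas_pos[OF x] eweight_pos[of _ x]
      by (auto simp: grad_sq_def less_imp_le intro!: divide_nonneg_nonneg mult_nonneg_nonneg sum_nonneg)
    then show "(sqrt (vmeas G x) * v x)\<^sup>2 \<le> vmeas G x * (grad_sq G v x + \<bar>v x\<bar>\<^sup>2)"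
      using vmeas_pos[OF x] by (simp add: power_mult_distrib distrib_left)
  qed auto
qed

lemma L2_on_iff:
  assumes "W \<subseteq> verts G"
  shows "h \<in> L2_on G W \<longleftrightarrow> (\<lambda>x. (sqrt (vmeas G x) * h x)\<^sup>2) summable_on W"
  unfolding L2_on_def integrable_over_def mem_Collect_eq
  using assms by (intro summable_on_cong) (auto simp: power_mult_distrib less_imp_le[OF vmeas_pos])

lemma L2_norm_on_power2:
  assumes "W \<subseteq> verts G"
  shows "(L2_norm_on G W h)\<^sup>2 = (\<Sum>\<^sub>\<infinity>x\<in>W. (sqrt (vmeas G x) * h x)\<^sup>2)"
proof -
  have "integral_over G W (\<lambda>x. \<bar>h x\<bar>\<^sup>2) = (\<Sum>\<^sub>\<infinity>x\<in>W. (sqrt (vmeas G x) * h x)\<^sup>2)"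
    unfolding integral_over_def
    using assms by (intro infsum_cong) (auto simp: power_mult_distrib less_imp_le[OF vmeas_pos])
  then show ?thesis by (simp add: L2_norm_on_def infsum_nonneg)
qed

text \<open>Giving each factor a square root of the vertex measure reduces weighted integrability to
  products of unweighted families.\<close>

lemma integrable_over_mult_diff_iff:
  assumes "W \<subseteq> verts G"
  shows "integrable_over G W (\<lambda>x. a x * (v x - b x)) \<longleftrightarrow>
    (\<lambda>x. (sqrt (vmeas G x) * a x) * (sqrt (vmeas G x) * v x - sqrt (vmeas G x) * b x)) summable_on W"
  unfolding integrable_over_def
proof (rule summable_on_cong)
  fix x assume "x \<in> W"
  then have "0 < vmeas G x" using assms vmeas_pos by blast
  have "(sqrt (vmeas G x) * a x) * (sqrt (vmeas G x) * v x - sqrt (vmeas G x) * b x)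
      = (sqrt (vmeas G x) * sqrt (vmeas G x)) * (a x * (v x - b x))"
    by (simp only: right_diff_distrib mult_ac)
  then show "vmeas G x * (a x * (v x - b x))
      = (sqrt (vmeas G x) * a x) * (sqrt (vmeas G x) * v x - sqrt (vmeas G x) * b x)"
    using \<open>0 < vmeas G x\<close> by auto
qed

text \<open>The scaling by the square root makes this an isometry from the weighted space on
  \<open>W\<close> to \<open>ell2\<close>. The value is meaningful only for \<open>h\<close> in
  \<open>L2_on G W\<close>.\<close>

definition to_ell2 :: "'a set \<Rightarrow> ('a \<Rightarrow> real) \<Rightarrow> 'a ell2" where
  "to_ell2 W h = Ell2 (\<lambda>x. if x \<in> W then sqrt (vmeas G x) * h x else 0)"

text \<open>Undoes the scaling and extends by zero, which builds in the boundary condition outside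
  \<open>W\<close>.\<close>

definition of_ell2 :: "'a set \<Rightarrow> 'a ell2 \<Rightarrow> 'a \<Rightarrow> real" where
  "of_ell2 W \<phi> x = (if x \<in> W then ell2_apply \<phi> x / sqrt (vmeas G x) else 0)"

lemma ell2_apply_to_ell2:
  assumes "W \<subseteq> verts G" "h \<in> L2_on G W"
  shows "ell2_apply (to_ell2 W h) x = (if x \<in> W then sqrt (vmeas G x) * h x else 0)"
proof -
  have "(\<lambda>x. (sqrt (vmeas G x) * h x)\<^sup>2) summable_on W \<longleftrightarrow>
      (\<lambda>x. (if x \<in> W then sqrt (vmeas G x) * h x else 0)\<^sup>2) summable_on UNIV"
    by (rule summable_on_cong_neutral) auto
  then show ?thesis
    using assms by (simp add: to_ell2_def Ell2_inverse L2_on_iff)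
qed

lemma norm_to_ell2:
  assumes "W \<subseteq> verts G" "h \<in> L2_on G W"
  shows "norm (to_ell2 W h) = L2_norm_on G W h"
proof -
  have "(norm (to_ell2 W h))\<^sup>2 = (L2_norm_on G W h)\<^sup>2"
    unfolding norm_ell2_power2 ell2_apply_to_ell2[OF assms] L2_norm_on_power2[OF assms(1)]
    by (rule infsum_cong_neutral) auto
  moreover have "0 \<le> L2_norm_on G W h"
    using assms(1) less_imp_le[OF vmeas_pos]
    by (auto simp: L2_norm_on_def integral_over_def intro!: infsum_nonneg mult_nonneg_nonneg)
  ultimately show ?thesis using power2_eq_imp_eq norm_ge_zero by blast
qed

lemma of_to_ell2:
  assumes "W \<subseteq> verts G" "h \<in> L2_on G W" "x \<in> W"
  shows "of_ell2 W (to_ell2 W h) x = h x"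
  using assms vmeas_pos[of x] by (auto simp: of_ell2_def ell2_apply_to_ell2)

lemma bounded_linear_of_ell2: "bounded_linear (\<lambda>\<phi>. of_ell2 W \<phi> x)"
  unfolding of_ell2_def using bounded_linear_divide[of "sqrt (vmeas G x)"] bounded_linear_ell2_apply[of x]
  by (cases "x \<in> W") (auto intro: bounded_linear_compose)

lemma of_ell2_square_summable:
  assumes "W \<subseteq> verts G"
  shows "(\<lambda>x. (sqrt (vmeas G x) * of_ell2 W \<phi> x)\<^sup>2) summable_on W"
proof -
  have "(\<lambda>x. (sqrt (vmeas G x) * of_ell2 W \<phi> x)\<^sup>2) summable_on W
      \<longleftrightarrow> (\<lambda>x. (ell2_apply \<phi> x)\<^sup>2) summable_on W"
    using assms vmeas_pos by (intro summable_on_cong) (force simp: of_ell2_def)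
  then show ?thesis by (simp add: summable_on_ell2_apply)
qed

text \<open>The Dirichlet Laplacian of \<open>W\<close>: extend by zero, apply the Laplacian of the
  graph, restrict to \<open>W\<close>.\<close>

definition laplacian_ell2 :: "'a set \<Rightarrow> 'a ell2 \<Rightarrow> 'a ell2" where
  "laplacian_ell2 W \<phi> = to_ell2 W (laplacian G (of_ell2 W \<phi>))"

text \<open>Finite weighted sums of the extended function are at most the squared norm of
  \<open>\<phi>\<close>, so \<open>sum_vmeas_laplacian_le\<close> bounds those of its Laplacian. One
  element \<open>\<psi>\<close> then provides both membership and norm bound.\<close>

lemma
  assumes W: "W \<subseteq> verts G"
  shows laplacian_of_ell2_L2: "laplacian G (of_ell2 W \<phi>) \<in> L2_on G W"
    and norm_laplacian_ell2_le: "norm (laplacian_ell2 W \<phi>) \<le> 2 * D * norm \<phi>"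
proof -
  let ?v = "of_ell2 W \<phi>"
  have M: "(\<Sum>x\<in>F. vmeas G x * (?v x)\<^sup>2) \<le> (norm \<phi>)\<^sup>2" if "finite F" "F \<subseteq> verts G" for F
  proof -
    have "(\<Sum>x\<in>F. vmeas G x * (?v x)\<^sup>2) \<le> (\<Sum>x\<in>F. (ell2_apply \<phi> x)\<^sup>2)"
      using that vmeas_pos by (intro sum_mono) (force simp: of_ell2_def power_divide)
    also have "\<dots> \<le> (norm \<phi>)\<^sup>2" using that by (intro sum_ell2_apply_le)
    finally show ?thesis .
  qed
  define h where "h x = (if x \<in> W then sqrt (vmeas G x) * laplacian G ?v x else 0)" for x
  have "(\<Sum>x\<in>F. (h x)\<^sup>2) \<le> (2 * D * norm \<phi>)\<^sup>2" if "finite F" for F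
  proof -
    have "(\<Sum>x\<in>F. (h x)\<^sup>2) = (\<Sum>x\<in>F \<inter> W. (h x)\<^sup>2)"
      using that by (intro sum.mono_neutral_right) (auto simp: h_def)
    also have "\<dots> = (\<Sum>x\<in>F \<inter> W. vmeas G x * (laplacian G ?v x)\<^sup>2)"
      using W vmeas_pos by (intro sum.cong) (force simp: h_def power_mult_distrib)+
    also have "\<dots> \<le> 4 * D\<^sup>2 * (norm \<phi>)\<^sup>2"
      using that W by (intro sum_vmeas_laplacian_le M) auto
    finally show ?thesis by (simp add: power_mult_distrib)
  qed
  then obtain \<psi> where \<psi>: "ell2_apply \<psi> = h" "norm \<psi> \<le> 2 * D * norm \<phi>"
    using D_nonneg by (elim ell2I[of h]) auto
  have "(\<lambda>x. (sqrt (vmeas G x) * laplacian G ?v x)\<^sup>2) summable_on W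
      \<longleftrightarrow> (\<lambda>x. (ell2_apply \<psi> x)\<^sup>2) summable_on W"
    by (intro summable_on_cong) (auto simp: \<psi> h_def)
  then show L2: "laplacian G ?v \<in> L2_on G W"
    using W by (simp add: summable_on_ell2_apply L2_on_iff)
  have "laplacian_ell2 W \<phi> = \<psi>"
    using ell2_apply_to_ell2[OF W L2] by (simp add: ell2_eq_iff laplacian_ell2_def \<psi> h_def)
  then show "norm (laplacian_ell2 W \<phi>) \<le> 2 * D * norm \<phi>" using \<psi> by simp
qed

lemma bounded_linear_laplacian_ell2:
  assumes W: "W \<subseteq> verts G"
  shows "bounded_linear (laplacian_ell2 W)"
proof (rule bounded_linear_intro[where K = "2 * D"])
  note ell2_apply_laplacian = ell2_apply_to_ell2[OF W laplacian_of_ell2_L2[OF W], folded laplacian_ell2_def]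
  fix \<phi> \<psi> :: "'a ell2" and r :: real
  have "of_ell2 W (\<phi> + \<psi>) = (\<lambda>x. of_ell2 W \<phi> x + of_ell2 W \<psi> x)"
    by (auto simp: of_ell2_def add_divide_distrib)
  then show "laplacian_ell2 W (\<phi> + \<psi>) = laplacian_ell2 W \<phi> + laplacian_ell2 W \<psi>"
    by (simp add: ell2_eq_iff ell2_apply_laplacian laplacian_add distrib_left)
  have "of_ell2 W (r *\<^sub>R \<phi>) = (\<lambda>x. r * of_ell2 W \<phi> x)"
    by (auto simp: of_ell2_def)
  then show "laplacian_ell2 W (r *\<^sub>R \<phi>) = r *\<^sub>R laplacian_ell2 W \<phi>"
    by (simp add: ell2_eq_iff ell2_apply_laplacian laplacian_cmult)
  show "norm (laplacian_ell2 W \<phi>) \<le> norm \<phi> * (2 * D)"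
    using norm_laplacian_ell2_le[OF W] by (simp add: mult.commute)
qed

lemma L2_on_add:
  assumes "W \<subseteq> verts G" "h \<in> L2_on G W" "k \<in> L2_on G W"
  shows "(\<lambda>x. h x + k x) \<in> L2_on G W"
  using assms summable_on_power2_add[of "\<lambda>x. sqrt (vmeas G x) * h x" W "\<lambda>x. sqrt (vmeas G x) * k x"]
  by (simp add: L2_on_iff distrib_left)

lemma vmeas_abs_le_L2_norm:
  assumes "W \<subseteq> verts G" "h \<in> L2_on G W" "x \<in> W"
  shows "sqrt (vmeas G x) * \<bar>h x\<bar> \<le> L2_norm_on G W h"
  using abs_ell2_apply_le[of "to_ell2 W h" x] assms vmeas_pos[of x]
  by (auto simp: ell2_apply_to_ell2 norm_to_ell2 abs_mult)

section \<open>Existence of solutions\<close>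

text \<open>The solution of the Dirichlet heat equation in \<open>ell2\<close> satisfies the
  equation at every point of \<open>W\<close>. The two integrands then coincide, and both factors
  are square-summable, so the integrals converge and are equal.\<close>

lemma solution_of_L2_source:
  assumes \<Omega>: "\<Omega> \<subseteq> verts G"
    and f_L2: "\<And>t. 0 \<le> t \<Longrightarrow> (\<lambda>x. f x t) \<in> L2_on G (vinterior G \<Omega>)"
    and f_lip: "\<And>t s. 0 \<le> t \<Longrightarrow> 0 \<le> s \<Longrightarrow>
      L2_norm_on G (vinterior G \<Omega>) (\<lambda>x. f x t - f x s) \<le> c * \<bar>t - s\<bar>"
    and f_diff_L2: "\<And>t s. 0 \<le> t \<Longrightarrow> 0 \<le> s \<Longrightarrow> (\<lambda>x. f x t - f x s) \<in> L2_on G (vinterior G \<Omega>)"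
    and g: "g \<in> L2_on G (vinterior G \<Omega>)"
  shows "\<exists>u. parabolic_VI_solution G \<Omega> f g u"
proof -
  define W where "W = vinterior G \<Omega>"
  have W: "W \<subseteq> verts G" using \<Omega> by (auto simp: W_def vinterior_def)
  note assms_W = f_L2[folded W_def] f_lip[folded W_def] f_diff_L2[folded W_def] g[folded W_def]
  interpret A: bounded_linear "laplacian_ell2 W"
    using W by (rule bounded_linear_laplacian_ell2)
  define F where "F t = to_ell2 W (\<lambda>x. f x t)" for t
  \<comment> \<open>A Lipschitz constant has to be nonnegative, hence the absolute value of
    \<open>c\<close>.\<close>
  have "dist (F t) (F s) \<le> \<bar>c\<bar> * dist t s" if "0 \<le> t" "0 \<le> s" for t s
  proof -
    have "F t - F s = to_ell2 W (\<lambda>x. f x t - f x s)"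
      using that by (simp add: ell2_eq_iff F_def ell2_apply_to_ell2[OF W] assms_W right_diff_distrib)
    then have "norm (F t - F s) = L2_norm_on G W (\<lambda>x. f x t - f x s)"
      using that by (simp add: norm_to_ell2[OF W] assms_W)
    also have "\<dots> \<le> c * \<bar>t - s\<bar>" using that by (rule assms_W)
    also have "\<dots> \<le> \<bar>c\<bar> * \<bar>t - s\<bar>" by (intro mult_right_mono) auto
    finally show ?thesis by (simp add: dist_norm)
  qed
  then have "\<bar>c\<bar>-lipschitz_on {0..} F" by (intro lipschitz_onI) auto
  then have F: "continuous_on {0..} F" by (rule lipschitz_on_continuous_on)
  obtain U where U0: "U 0 = to_ell2 W g" and
    U: "\<And>t. t \<ge> 0 \<Longrightarrow> (U has_vector_derivative laplacian_ell2 W (U t) + F t) (at t within {0..})"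
    using inhomogeneous_linear_ode_solution[OF A.bounded_linear_axioms F, of "to_ell2 W g"] by blast
  define u where "u x t = of_ell2 W (U t) x" for x t
  define u' where "u' x t = of_ell2 W (laplacian_ell2 W (U t) + F t) x" for x t
  have U_cont: "continuous_on {0..} U"
    by (rule continuous_on_vector_derivative) (rule U, simp)
  have u_lap: "(\<lambda>y. u y t) = of_ell2 W (U t)" for t by (simp add: u_def fun_eq_iff)
  have eq: "u' x t = laplacian G (\<lambda>y. u y t) x + f x t" if "x \<in> W" "0 \<le> t" for x t
  proof -
    have "u' x t = of_ell2 W (laplacian_ell2 W (U t)) x + of_ell2 W (F t) x"
      by (simp add: u'_def of_ell2_def add_divide_distrib)
    then show ?thesis
      using that by (simp add: F_def laplacian_ell2_def of_to_ell2[OF W] assms_W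
          laplacian_of_ell2_L2[OF W] u_lap)
  qed
  have deriv: "(u x has_real_derivative u' x t) (at t within {0..})" if "0 \<le> t" for x t
    using bounded_linear.has_vector_derivative[OF bounded_linear_of_ell2 U[OF that], of W x]
    unfolding u_def u'_def has_real_derivative_iff_has_vector_derivative .
  have cont: "continuous_on {0..} (u' x)" for x
    unfolding u'_def
    by (intro bounded_linear.continuous_on[OF bounded_linear_of_ell2] continuous_intros
        A.continuous_on U_cont F)
  have integrable: "integrable_over G W (\<lambda>x. u' x t * (v x - u x t))"
    if v: "v \<in> test_space G \<Omega>" for v t
  proof -
    have "(\<lambda>x. (sqrt (vmeas G x) * v x)\<^sup>2) summable_on W"
      using test_space_square_summable[OF v] W by (rule summable_on_subset_banach)
    moreover have "(\<lambda>x. (sqrt (vmeas G x) * - u x t)\<^sup>2) summable_on W"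
      using of_ell2_square_summable[OF W, of "U t"] by (simp add: u_def)
    ultimately have "(\<lambda>x. (sqrt (vmeas G x) * v x + sqrt (vmeas G x) * - u x t)\<^sup>2) summable_on W"
      by (rule summable_on_power2_add)
    with of_ell2_square_summable[OF W, of "laplacian_ell2 W (U t) + F t", folded u'_def]
    have "(\<lambda>x. (sqrt (vmeas G x) * u' x t)
        * (sqrt (vmeas G x) * v x + sqrt (vmeas G x) * - u x t)) summable_on W"
      by (rule summable_on_mult_of_squares)
    then show ?thesis
      by (simp add: integrable_over_mult_diff_iff[OF W])
  qed
  have "parabolic_VI_solution G \<Omega> f g u"
    unfolding parabolic_VI_solution_def Let_def W_def[symmetric]
  proof (intro conjI exI[of _ u'] ballI allI impI)
    fix t :: real and v assume t: "0 \<le> t" and v: "v \<in> test_space G \<Omega>"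
    show "integrable_over G W (\<lambda>x. u' x t * (v x - u x t))" using v by (rule integrable)
    then show "integrable_over G W (\<lambda>x. (laplacian G (\<lambda>y. u y t) x + f x t) * (v x - u x t))"
      using t by (simp add: integrable_over_def eq cong: summable_on_cong)
    show "integral_over G W (\<lambda>x. (laplacian G (\<lambda>y. u y t) x + f x t) * (v x - u x t))
        \<le> integral_over G W (\<lambda>x. u' x t * (v x - u x t))"
      using t by (simp add: integral_over_def eq cong: infsum_cong)
  next
    fix x assume "x \<in> W"
    then show "u x 0 = g x" by (simp add: u_def U0 of_to_ell2[OF W] assms_W)
  next
    fix x t assume "x \<in> verts G - W"
    then show "u x t = 0" by (simp add: u_def of_ell2_def)
  qed (use deriv cont in auto)
  then show ?thesis by blast
qed

text \<open>The function is \<open>g' + t h + t^2 \<kappa>\<close>. The part linear in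
  \<open>t\<close> is fixed by the equation at time 0, where the quadratic part and its derivative
  vanish. The integrability clause in \<open>parabolic_VI_solution\<close> is vacuous here, as no
  \<open>f(., t)\<close> is square-summable.\<close>

lemma solution_of_non_L2_source:
  assumes \<Omega>: "\<Omega> \<subseteq> verts G"
    and f0: "(\<lambda>x. f x 0) \<notin> L2_on G (vinterior G \<Omega>)"
    and f_lip: "\<And>t s. 0 \<le> t \<Longrightarrow> 0 \<le> s \<Longrightarrow>
      L2_norm_on G (vinterior G \<Omega>) (\<lambda>x. f x t - f x s) \<le> c * \<bar>t - s\<bar>"
    and f_diff_L2: "\<And>t s. 0 \<le> t \<Longrightarrow> 0 \<le> s \<Longrightarrow> (\<lambda>x. f x t - f x s) \<in> L2_on G (vinterior G \<Omega>)"
  shows "\<exists>u. parabolic_VI_solution G \<Omega> f g u"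
proof -
  define W where "W = vinterior G \<Omega>"
  have W: "W \<subseteq> verts G" using \<Omega> by (auto simp: W_def vinterior_def)
  note assms_W = f0[folded W_def] f_lip[folded W_def] f_diff_L2[folded W_def]
  \<comment> \<open>Otherwise adding the square-summable difference between times 0 and
    \<open>t\<close> would make \<open>f(., 0)\<close> square-summable.\<close>
  have not_L2: "(\<lambda>x. f x t) \<notin> L2_on G W" if "0 \<le> t" for t
    using L2_on_add[OF W _ assms_W(3)[of 0 t], of "\<lambda>x. f x t"] that assms_W(1) by auto
  have inf: "infinite W"
    using assms_W(1) by (auto simp: L2_on_iff[OF W])
  then obtain s :: "nat \<Rightarrow> 'a" where s: "inj s" "range s \<subseteq> W" "\<And>i j. i < j \<Longrightarrow> s j \<notin> nbrs G (s i)"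
    using infinite_independent_sequence[of W "nbrs G"] finite_nbrs W by blast
  have sW: "s n \<in> W" "s n \<in> verts G" for n using s W by auto
  have indep: "s j \<notin> nbrs G (s i)" for i j
  proof (cases i j rule: linorder_cases)
    case less
    then show ?thesis by (rule s(3))
  next
    case equal
    then show ?thesis by (simp add: not_in_nbrs_self)
  next
    case greater
    from s(3)[OF this] show ?thesis using nbrs_sym[OF sW(2)] by blast
  qed
  define g' where "g' x = (if x \<in> W then g x else 0)" for x
  define h where "h x = (if x \<in> W then laplacian G g' x + f x 0 else 0)" for x
  define d where "d x = (\<Sum>y\<in>nbrs G x. eweight G x y) / vmeas G x" for x
  have d_pos: "0 < d x" if "x \<in> verts G" for x
    unfolding d_def using that eweight_pos
    by (intro divide_pos_pos sum_pos finite_nbrs nbrs_nonempty vmeas_pos)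
  \<comment> \<open>The coefficient at \<open>s n\<close> is tuned to dominate all other terms for times in \<open>[1/(n+1), n+1]\<close>.\<close>
  define P where "P n q \<longleftrightarrow> 0 \<le> q
      \<and> 1 + sqrt (vmeas G (s n)) * (\<bar>g' (s n)\<bar> + real (Suc n) * \<bar>h (s n)\<bar>) \<le> sqrt (vmeas G (s n)) * q
      \<and> 1 + \<bar>c\<bar> * real (Suc n) + sqrt (vmeas G (s n)) *
          (\<bar>laplacian G g' (s n)\<bar> + real (Suc n) * \<bar>laplacian G h (s n)\<bar> + \<bar>f (s n) 0\<bar>)
        \<le> (sqrt (vmeas G (s n)) * d (s n)) * q" for n q
  have "\<exists>q. P n q" for n
  proof -
    have ex: "\<exists>q::real. 0 \<le> q \<and> A \<le> a * q \<and> B \<le> b * q" if "0 < a" "0 < b" for a b A B :: real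
    proof (intro exI conjI)
      let ?q = "max 0 (max (A / a) (B / b))"
      show "0 \<le> ?q" by simp
      have "A / a \<le> ?q" "B / b \<le> ?q" by linarith+
      then show "A \<le> a * ?q" "B \<le> b * ?q"
        using that by (simp_all only: pos_divide_le_eq mult.commute)
    qed
    show ?thesis
      unfolding P_def by (rule ex) (use vmeas_pos d_pos sW in auto)
  qed
  then obtain q where q: "\<And>n. P n (q n)" by metis
  \<comment> \<open>For \<open>t\<close> at least \<open>1/(n+1)\<close>, the factor
    \<open>(n+1)^2\<close> keeps both \<open>t^2 * \<kappa>\<close> and \<open>t * \<kappa>\<close>
    at \<open>s n\<close> above \<open>q n\<close>.\<close>
  define \<kappa> where "\<kappa> x = (if x \<in> range s then q (inv s x) * (real (Suc (inv s x)))\<^sup>2 else 0)" for x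
  have \<kappa>_s: "\<kappa> (s n) = q n * (real (Suc n))\<^sup>2" for n
    using s(1) by (simp add: \<kappa>_def)
  \<comment> \<open>All neighbours of \<open>s n\<close> lie off the sequence, where
    \<open>\<kappa>\<close> is zero.\<close>
  have lap_\<kappa>: "laplacian G \<kappa> (s n) = - d (s n) * \<kappa> (s n)" for n
  proof -
    have "(\<Sum>y\<in>nbrs G (s n). eweight G (s n) y * (\<kappa> y - \<kappa> (s n)))
        = (\<Sum>y\<in>nbrs G (s n). eweight G (s n) y * - \<kappa> (s n))"
      by (rule sum.cong) (use indep in \<open>auto simp: \<kappa>_def\<close>)
    then show ?thesis by (simp add: laplacian_def d_def sum_negf flip: sum_distrib_right)
  qed
  define u where "u x t = g' x + (t * h x + t\<^sup>2 * \<kappa> x)" for x t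
  define u' where "u' x t = h x + 2 * t * \<kappa> x" for x t
  have lap_u: "laplacian G (\<lambda>y. u y t) x = laplacian G g' x + (t * laplacian G h x + t\<^sup>2 * laplacian G \<kappa> x)" for x t
    by (simp add: u_def laplacian_add laplacian_cmult)
  have large: "1 \<le> \<bar>sqrt (vmeas G (s n)) * u (s n) t\<bar>"
      "1 \<le> \<bar>sqrt (vmeas G (s n)) * u' (s n) t\<bar>"
      "1 \<le> \<bar>sqrt (vmeas G (s n)) * (laplacian G (\<lambda>y. u y t) (s n) + f (s n) t)\<bar>"
    if t: "1 / real (Suc n) \<le> t" "t \<le> real (Suc n)" for n t
  proof -
    define T where "T = real (Suc n)"
    define m where "m = sqrt (vmeas G (s n))"
    let ?x = "s n"
    note Pq = q[of n, unfolded P_def, folded T_def m_def]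
    have m: "0 < m" using vmeas_pos[OF sW(2)] by (simp add: m_def)
    have T: "1 \<le> T" "1 \<le> t * T" "t \<le> T" "0 < t"
      using t by (auto simp: T_def field_simps intro: less_le_trans[of 0 "1 / (1 + real n)"])
    have "1 \<le> (t * T)\<^sup>2" using T(2) by simp
    then have t2: "q n \<le> t\<^sup>2 * \<kappa> ?x"
      using mult_left_mono[of 1 "(t * T)\<^sup>2" "q n"] Pq
      by (simp add: \<kappa>_s T_def power_mult_distrib mult_ac)
    have "1 * 1 \<le> (t * T) * T" using T by (intro mult_mono) auto
    then have t1: "q n \<le> t * \<kappa> ?x"
      using mult_left_mono[of 1 "(t * T) * T" "q n"] Pq
      by (simp add: \<kappa>_s T_def power2_eq_square mult_ac)
    have th: "t * \<bar>y\<bar> \<le> T * \<bar>y\<bar>" for y using T by (intro mult_right_mono) auto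
    have "m * q n \<le> m * (u ?x t + \<bar>g' ?x\<bar> + T * \<bar>h ?x\<bar>)"
      using t2 th[of "h ?x"] T m
        abs_ge_minus_self[of "t * h ?x"] by (intro mult_left_mono) (auto simp: u_def abs_mult)
    then have "1 \<le> m * u ?x t" using Pq by (simp add: distrib_left)
    then show "1 \<le> \<bar>sqrt (vmeas G ?x) * u ?x t\<bar>" by (simp add: m_def)
    \<comment> \<open>The derivative contains \<open>2 * t * \<kappa>\<close>, at least twice
      \<open>q n\<close>; nonnegativity allows dropping one copy.\<close>
    have "0 \<le> q n" using Pq by simp
    have "1 * \<bar>h ?x\<bar> \<le> T * \<bar>h ?x\<bar>" using T by (intro mult_right_mono) auto
    then have "m * q n \<le> m * (u' ?x t + (\<bar>g' ?x\<bar> + T * \<bar>h ?x\<bar>))"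
      using t1 m \<open>0 \<le> q n\<close> by (intro mult_left_mono) (auto simp: u'_def)
    then have "1 \<le> m * u' ?x t" using Pq by (simp add: distrib_left)
    then show "1 \<le> \<bar>sqrt (vmeas G ?x) * u' ?x t\<bar>" by (simp add: m_def)
    let ?R = "laplacian G (\<lambda>y. u y t) ?x + f ?x t"
    \<comment> \<open>A single vertex contributes at most the whole norm, so the Lipschitz bound
      controls \<open>f\<close> at \<open>s n\<close>.\<close>
    have "m * \<bar>f ?x t - f ?x 0\<bar> \<le> c * t"
      using vmeas_abs_le_L2_norm[OF W assms_W(3) sW(1), of t 0 n] assms_W(2)[of t 0] T by (simp add: m_def)
    also have "\<dots> \<le> \<bar>c\<bar> * T" using T by (intro mult_mono) auto
    finally have ft: "m * (f ?x t - f ?x 0) \<le> \<bar>c\<bar> * T"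
      using m mult_left_mono[OF abs_ge_self[of "f ?x t - f ?x 0"], of m] by linarith
    have "d ?x * q n \<le> d ?x * (t\<^sup>2 * \<kappa> ?x)"
      using t2 d_pos[OF sW(2)] by (intro mult_left_mono) (auto simp: less_imp_le)
    moreover have "?R = laplacian G g' ?x + t * laplacian G h ?x - d ?x * (t\<^sup>2 * \<kappa> ?x)
        + f ?x 0 + (f ?x t - f ?x 0)"
      by (simp add: lap_u lap_\<kappa>)
    moreover have "t * laplacian G h ?x \<le> T * \<bar>laplacian G h ?x\<bar>"
      using th[of "laplacian G h ?x"] mult_left_mono[OF abs_ge_self[of "laplacian G h ?x"], of t] T
      by linarith
    ultimately have "d ?x * q n \<le> - ?R + (\<bar>laplacian G g' ?x\<bar> + T * \<bar>laplacian G h ?x\<bar> + \<bar>f ?x 0\<bar>)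
        + (f ?x t - f ?x 0)"
      using abs_ge_self[of "laplacian G g' ?x"] abs_ge_self[of "f ?x 0"] by linarith
    then have "m * (d ?x * q n) \<le> m * (- ?R + (\<bar>laplacian G g' ?x\<bar> + T * \<bar>laplacian G h ?x\<bar> + \<bar>f ?x 0\<bar>)
        + (f ?x t - f ?x 0))"
      using m by (intro mult_left_mono) auto
    also have "\<dots> = - (m * ?R) + m * (\<bar>laplacian G g' ?x\<bar> + T * \<bar>laplacian G h ?x\<bar> + \<bar>f ?x 0\<bar>)
        + m * (f ?x t - f ?x 0)"
      by (simp only: distrib_left mult_minus_right)
    \<comment> \<open>The Laplacian of \<open>\<kappa>\<close> is negative at \<open>s n\<close>, so
      this quantity is large with negative sign, unlike \<open>u\<close> and
      \<open>u'\<close>.\<close>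
    finally have "1 \<le> - (m * ?R)" using Pq ft by (simp only: mult.assoc) linarith
    then show "1 \<le> \<bar>sqrt (vmeas G ?x) * ?R\<bar>" by (simp only: m_def abs_ge_minus_self order_trans[rotated])
  qed
  \<comment> \<open>At positive times neither integrand is summable, so both integrals take the value 0.\<close>
  have vanish: "integral_over G W (\<lambda>x. a x * (v x - u x t)) = 0"
    if v: "v \<in> test_space G \<Omega>" and t: "0 < t"
      and a: "\<And>n. 1 / real (Suc n) \<le> t \<Longrightarrow> t \<le> real (Suc n) \<Longrightarrow> 1 \<le> \<bar>sqrt (vmeas G (s n)) * a (s n)\<bar>"
    for v a t
  proof -
    \<comment> \<open>From index \<open>M\<close> on, the fixed time \<open>t\<close> lies in the
      window in which \<open>large\<close> applies; this tail of the sequence is still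
      infinite.\<close>
    obtain M where M: "max t (1 / t) \<le> real M" using real_arch_simple by blast
    have bounds: "1 / real (Suc n) \<le> t" "t \<le> real (Suc n)" if "M \<le> n" for n
    proof -
      have le: "max t (1 / t) \<le> real (Suc n)" using M that by linarith
      then show "t \<le> real (Suc n)" by simp
      have "1 / t \<le> real (Suc n)" using le by simp
      then show "1 / real (Suc n) \<le> t" using t by (simp add: field_simps)
    qed
    have "\<not> (\<lambda>x. (sqrt (vmeas G x) * a x) * (sqrt (vmeas G x) * v x - sqrt (vmeas G x) * u x t)) summable_on W"
    proof (rule not_summable_on_mult_diff[where I = "s ` {M..}"])
      show "(\<lambda>x. (sqrt (vmeas G x) * v x)\<^sup>2) summable_on W"
        using test_space_square_summable[OF v] W by (rule summable_on_subset_banach)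
      show "infinite (s ` {M..})"
        using s(1) finite_imageD[of s "{M..}"] infinite_Ici[of M] by (auto intro: inj_on_subset)
      show "s ` {M..} \<subseteq> W" using sW by auto
    qed (use a large(1) bounds in auto)
    then have "\<not> integrable_over G W (\<lambda>x. a x * (v x - u x t))"
      by (simp add: integrable_over_mult_diff_iff[OF W])
    then show ?thesis
      unfolding integral_over_def integrable_over_def by (rule infsum_not_exists)
  qed
  have off: "u x t = 0" if "x \<notin> W" for x t
    using that s(2) by (auto simp: u_def g'_def h_def \<kappa>_def)
  have "parabolic_VI_solution G \<Omega> f g u"
    unfolding parabolic_VI_solution_def Let_def W_def[symmetric]
  proof (intro conjI exI[of _ u'] ballI allI impI)
    fix x t
    show "(u x has_real_derivative u' x t) (at t within {0..})"
      unfolding u_def u'_def by (auto intro!: derivative_eq_intros)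
    show "continuous_on {0..} (u' x)"
      unfolding u'_def by (intro continuous_intros)
  next
    fix t :: real and v assume t: "0 \<le> t" and v: "v \<in> test_space G \<Omega>"
    show "integral_over G W (\<lambda>x. (laplacian G (\<lambda>y. u y t) x + f x t) * (v x - u x t))
        \<le> integral_over G W (\<lambda>x. u' x t * (v x - u x t))"
    \<comment> \<open>At time 0 the integrands agree pointwise, so the integrals are equal whether
      or not they converge. At positive times the claim reads \<open>0 \<le> 0\<close>.\<close>
    proof (cases "t = 0")
      case True
      then have "u' x t = laplacian G (\<lambda>y. u y t) x + f x t" if "x \<in> W" for x
        using that unfolding lap_u by (simp add: u'_def h_def)
      then show ?thesis by (simp add: integral_over_def cong: infsum_cong)
    next
      case False
      then show ?thesis
        using t vanish[OF v, of t "\<lambda>x. u' x t"] large(2)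
          vanish[OF v, of t "\<lambda>x. laplacian G (\<lambda>y. u y t) x + f x t"] large(3) by simp
    qed
  next
    fix x assume "x \<in> W"
    then show "u x 0 = g x" by (simp add: u_def g'_def)
  qed (use off not_L2 in auto)
  then show ?thesis by blast
qed

end

theorem theorem1p5:
  fixes G :: "'a weighted_graph"
    and \<Omega> :: "'a set"
    and f :: "'a \<Rightarrow> real \<Rightarrow> real"
    and g :: "'a \<Rightarrow> real"
  assumes "locally_finite_connected_weighted_graph G"
    and "(INF x\<in>verts G. vmeas G x) > 0"
    and "bdd_above (deg G ` verts G)"
    and "bdd_above ((\<lambda>x. 1 / vmeas G x * (\<Sum>y\<in>nbrs G x. eweight G x y)) ` verts G)"
    and "\<Omega> \<subseteq> verts G"
    and "\<not> graph_bounded G \<Omega>"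
    and "vinterior G \<Omega> \<noteq> {}"
    and "\<exists>c>0. \<forall>t\<ge>0. \<forall>s\<ge>0.
           (\<lambda>x. f x t - f x s) \<in> L2_on G (vinterior G \<Omega>) \<and>
           L2_norm_on G (vinterior G \<Omega>) (\<lambda>x. f x t - f x s) \<le> c * \<bar>t - s\<bar>"
    and "g \<in> L2_on G (vinterior G \<Omega>)"
  shows "\<exists>u :: 'a \<Rightarrow> real \<Rightarrow> real. parabolic_VI_solution G \<Omega> f g u"
proof -
  obtain D where D: "\<And>x. x \<in> verts G \<Longrightarrow> 1 / vmeas G x * (\<Sum>y\<in>nbrs G x. eweight G x y) \<le> D"
    using assms(4) unfolding bdd_above_def by blast
  \<comment> \<open>The maximum with 0 supplies the nonnegativity required by the locale.\<close>
  interpret bounded_weighted_graph G "max 0 D"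
  proof
    fix x assume x: "x \<in> verts G"
    then have m: "0 < vmeas G x"
      using assms(1) by (auto simp: locally_finite_connected_weighted_graph_def)
    have "(\<Sum>y\<in>nbrs G x. eweight G x y) \<le> D * vmeas G x"
      using D[OF x] m by (simp add: field_simps)
    also have "\<dots> \<le> max 0 D * vmeas G x"
      using m by (intro mult_right_mono) auto
    finally show "(\<Sum>y\<in>nbrs G x. eweight G x y) \<le> max 0 D * vmeas G x" .
  qed (use assms(1) in auto)
  obtain c where
    f_diff_L2: "\<And>t s. 0 \<le> t \<Longrightarrow> 0 \<le> s \<Longrightarrow> (\<lambda>x. f x t - f x s) \<in> L2_on G (vinterior G \<Omega>)" and
    f_lip: "\<And>t s. 0 \<le> t \<Longrightarrow> 0 \<le> s \<Longrightarrow>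
      L2_norm_on G (vinterior G \<Omega>) (\<lambda>x. f x t - f x s) \<le> c * \<bar>t - s\<bar>"
    using assms(8) by blast
  show ?thesis
  \<comment> \<open>Differences of \<open>f\<close> in time are square-summable, so time 0 decides
    for all times.\<close>
  proof (cases "(\<lambda>x. f x 0) \<in> L2_on G (vinterior G \<Omega>)")
    case True
    have "(\<lambda>x. f x t) \<in> L2_on G (vinterior G \<Omega>)" if "0 \<le> t" for t
      using L2_on_add[OF _ True f_diff_L2[of t 0]] that assms(5) by (auto simp: vinterior_def)
    then show ?thesis
      using solution_of_L2_source[OF assms(5) _ f_lip f_diff_L2 assms(9)] by blast
  next
    case False
    then show ?thesis
      using solution_of_non_L2_source[OF assms(5) False f_lip f_diff_L2] by blast
  qed
qed

end
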